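(* For any graphs $G$ and $H$, $$\chi_{2}^{f}(H)+\Big\lceil\frac{\Delta(G)|V(H)|}{2}\Big\rceil\leq \chi_{2}^{f}(G\circ H)\leq \chi_{2}^{f}(G)|V(H)|.$$ These bounds are sharp, i.e., each of the two inequalities is attained with equality for some $G$ and $H$.
   Context: All graphs are finite and simple, with nonempty vertex set; $\Delta(G)$ is the maximum degree of $G$. The lexicographic product $G\circ H$ has vertex set $V(G)\times V(H)$, with $(g,h)$ and $(g',h')$ adjacent if either $gg'\in E(G)$, or $g=g'$ and $hh'\in E(H)$. A $2$-frugal coloring of a graph is a proper vertex coloring in which no color appears more than twice in the (open) neighborhood of any vertex; $\chi_2^f(G)$ is the minimum number of colors in a $2$-frugal coloring of $G$. *)

theory Defs
  imports Complex_Main "Graph_Theory.Pair_Digraph"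
begin

text \<open>
  A finite simple graph is a \<^locale>\<open>pair_graph\<close>: a finite, symmetric, loop-free digraph without
  parallel arcs, each edge being represented by its two opposite arcs.  That locale admits the
  graph without vertices, which is excluded here.
\<close>

definition simple_graph :: "'a pair_pre_digraph \<Rightarrow> bool" where
  "simple_graph G \<longleftrightarrow> pair_graph G \<and> pverts G \<noteq> {}"

definition neighborhood :: "'a pair_pre_digraph \<Rightarrow> 'a \<Rightarrow> 'a set" where
  "neighborhood G v = {u \<in> pverts G. (v, u) \<in> parcs G}"

text \<open>
  An edge at \<open>v\<close> contributes exactly one arc leaving \<open>v\<close>, so the degree of \<open>v\<close> is its out-degree.
\<close>

definition max_degree :: "'a pair_pre_digraph \<Rightarrow> nat" where
  "max_degree G = Max (out_degree (with_proj G) ` pverts G)"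

definition lex_product ::
    "'a pair_pre_digraph \<Rightarrow> 'b pair_pre_digraph \<Rightarrow> ('a \<times> 'b) pair_pre_digraph" where
  "lex_product G H =
    \<lparr> pverts = pverts G \<times> pverts H,
      parcs = {((g, h), (g', h')) | g h g' h'.
        g \<in> pverts G \<and> h \<in> pverts H \<and> g' \<in> pverts G \<and> h' \<in> pverts H \<and>
        ((g, g') \<in> parcs G \<or> g = g' \<and> (h, h') \<in> parcs H)} \<rparr>"

definition proper_coloring :: "'a pair_pre_digraph \<Rightarrow> ('a \<Rightarrow> 'c) \<Rightarrow> bool" where
  "proper_coloring G c \<longleftrightarrow> (\<forall>(u, v) \<in> parcs G. c u \<noteq> c v)"

definition frugal_coloring :: "nat \<Rightarrow> 'a pair_pre_digraph \<Rightarrow> ('a \<Rightarrow> 'c) \<Rightarrow> bool" where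
  "frugal_coloring t G c \<longleftrightarrow> proper_coloring G c \<and>
    (\<forall>v \<in> pverts G. \<forall>k. card {u \<in> neighborhood G v. c u = k} \<le> t)"

definition frugal_chromatic_number :: "nat \<Rightarrow> 'a pair_pre_digraph \<Rightarrow> nat" where
  "frugal_chromatic_number t G =
    (LEAST n. \<exists>c :: 'a \<Rightarrow> nat. frugal_coloring t G c \<and> card (c ` pverts G) = n)"

text \<open>
  The lexicographic product stays within the class of graphs considered, and the minimum defining
  the frugal chromatic number is attained.
\<close>

lemma simple_graph_lex_product:
  assumes "simple_graph G" and "simple_graph H"
  shows "simple_graph (lex_product G H)"
proof -
  interpret G: pair_graph G using assms(1) by (simp add: simple_graph_def)
  interpret H: pair_graph H using assms(2) by (simp add: simple_graph_def)
  let ?P = "lex_product G H"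
  have fin: "finite (pverts ?P)"
    using G.pair_finite_verts H.pair_finite_verts by (simp add: lex_product_def)
  have "parcs ?P \<subseteq> pverts ?P \<times> pverts ?P"
    by (auto simp: lex_product_def)
  then have fin_arcs: "finite (parcs ?P)"
    using fin finite_subset by blast
  have "sym (parcs G)" "sym (parcs H)"
    using G.pair_sym_arcs H.pair_sym_arcs by (auto simp: symmetric_def)
  then have "symmetric ?P"
    by (auto simp: symmetric_def lex_product_def sym_def)
  moreover have "fst e \<noteq> snd e" if "e \<in> parcs ?P" for e
    using that G.pair_no_loops H.pair_no_loops by (fastforce simp: lex_product_def)
  ultimately have "pair_graph ?P"
    using fin fin_arcs by unfold_locales (auto simp: lex_product_def)
  then show ?thesis
    using assms by (auto simp: simple_graph_def lex_product_def)
qed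

lemma frugal_chromatic_number_attained:
  fixes G :: "'a pair_pre_digraph"
  assumes "simple_graph G" and "t \<ge> 1"
  shows "\<exists>c :: 'a \<Rightarrow> nat. frugal_coloring t G c \<and>
    card (c ` pverts G) = frugal_chromatic_number t G"
proof -
  interpret G: pair_graph G using assms(1) by (simp add: simple_graph_def)
  obtain c :: "'a \<Rightarrow> nat" where c: "inj_on c (pverts G)"
    using G.pair_finite_verts finite_imp_inj_to_nat_seg by blast
  have "proper_coloring G c"
    unfolding proper_coloring_def
  proof clarify
    fix u v assume uv: "(u, v) \<in> parcs G" and "c u = c v"
    then have "u = v"
      using c G.wellformed' by (meson inj_onD)
    then show False
      using uv G.pair_no_loops[of "(u, v)"] by simp
  qed
  moreover have "card {u \<in> neighborhood G v. c u = k} \<le> t" for v k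
  proof -
    have "x = y" if "x \<in> {u \<in> neighborhood G v. c u = k}" "y \<in> {u \<in> neighborhood G v. c u = k}"
      for x y
      using that c by (auto simp: neighborhood_def inj_on_def)
    then have "card {u \<in> neighborhood G v. c u = k} \<le> 1"
      using card_le_Suc0_iff_eq[of "{u \<in> neighborhood G v. c u = k}"] G.pair_finite_verts
      by (auto simp: neighborhood_def)
    then show ?thesis using assms(2) by linarith
  qed
  ultimately have "\<exists>n. \<exists>c :: 'a \<Rightarrow> nat. frugal_coloring t G c \<and> card (c ` pverts G) = n"
    by (auto simp: frugal_coloring_def)
  then show ?thesis
    unfolding frugal_chromatic_number_def by (rule LeastI_ex)
qed

end

theory Submission
  imports Defs
begin

text \<open>
  Write \<open>\<chi>(G)\<close> for the \<open>t\<close>-frugal chromatic number.  Each fibre \<open>{g} \<times> V(H)\<close> of the lexicographic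
  product induces a copy of \<open>H\<close>, and each of its vertices is adjacent to everything that lies over
  the neighbours of \<open>g\<close>.

  Lower bound.  Take \<open>g\<close> of maximum degree.  A frugal coloring of the product uses at least
  \<open>\<chi>(H)\<close> colors on the fibre over \<open>g\<close>.  The \<open>\<Delta>(G) |V(H)|\<close> vertices over the neighbours of \<open>g\<close> all
  lie in the neighborhood of one vertex of that fibre, so every color occurs at most \<open>t\<close> times
  among them, and they need at least \<open>\<Delta>(G) |V(H)| / t\<close> colors.  By properness these are new colors
  (\<open>frugal_chromatic_number_lex_product_lower\<close>).

  Upper bound.  If \<open>c\<close> is a frugal coloring of \<open>G\<close>, then coloring \<open>(g, h)\<close> with \<open>(c g, h)\<close> is
  frugal: a color class in a neighborhood has a constant second coordinate, so it is a
  color class of \<open>c\<close> in a neighborhood of \<open>G\<close>, or a single vertex of the fibre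
  (\<open>frugal_chromatic_number_lex_product_upper\<close>).

  Sharpness.  For \<open>G = K\<^sub>2\<close> and \<open>H = K\<^sub>1\<close> both bounds equal \<open>2\<close>, so the chain of inequalities
  collapses.
\<close>

section \<open>Neighborhoods and frugal colorings\<close>

lemma simple_graph_finite_verts: "simple_graph G \<Longrightarrow> finite (pverts G)"
proof -
  assume "simple_graph G"
  then interpret pair_graph G by (simp add: simple_graph_def)
  show "finite (pverts G)" by (rule pair_finite_verts)
qed

lemma simple_graph_arc_verts:
  assumes "simple_graph G" "(u, v) \<in> parcs G"
  shows "u \<in> pverts G" "v \<in> pverts G" "u \<noteq> v"
proof -
  interpret pair_graph G using assms(1) by (simp add: simple_graph_def)
  show "u \<in> pverts G" "v \<in> pverts G" using assms(2) wellformed' by auto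
  show "u \<noteq> v" using assms(2) pair_no_loops[of "(u, v)"] by auto
qed

lemma out_degree_eq_card_neighborhood:
  assumes "simple_graph G"
  shows "out_degree (with_proj G) v = card (neighborhood G v)"
proof -
  have "out_arcs (with_proj G) v = Pair v ` neighborhood G v"
    using simple_graph_arc_verts[OF assms] by (auto simp: out_arcs_def neighborhood_def)
  then show ?thesis
    by (simp add: out_degree_def card_image inj_on_def)
qed

lemma max_degree_attained:
  assumes "simple_graph G"
  obtains v where "v \<in> pverts G" "card (neighborhood G v) = max_degree G"
proof -
  have "max_degree G \<in> out_degree (with_proj G) ` pverts G"
    unfolding max_degree_def
    using assms by (intro Max_in) (auto simp: simple_graph_finite_verts simple_graph_def)
  then show thesis
    using that out_degree_eq_card_neighborhood[OF assms] by auto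
qed

text \<open>
  The chromatic number is a minimum over colorings by natural numbers.  As only finitely many
  colors occur, they can be renamed injectively, so colorings of any type give upper bounds.
\<close>

lemma frugal_chromatic_number_le:
  fixes c :: "'a \<Rightarrow> 'c"
  assumes G: "simple_graph G" and c: "frugal_coloring t G c"
  shows "frugal_chromatic_number t G \<le> card (c ` pverts G)"
proof -
  have fin: "finite (c ` pverts G)"
    using G by (simp add: simple_graph_finite_verts)
  obtain f :: "'c \<Rightarrow> nat" where f: "inj_on f (c ` pverts G)"
    using finite_imp_inj_to_nat_seg[OF fin] by auto
  have "proper_coloring G (f \<circ> c)"
    unfolding proper_coloring_def
  proof clarify
    fix u v assume uv: "(u, v) \<in> parcs G" and "(f \<circ> c) u = (f \<circ> c) v"
    then have "c u = c v"
      using simple_graph_arc_verts[OF G uv] by (intro inj_onD[OF f]) auto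
    then show False
      using c uv by (auto simp: frugal_coloring_def proper_coloring_def)
  qed
  moreover have "card {u \<in> neighborhood G v. (f \<circ> c) u = k} \<le> t" if v: "v \<in> pverts G" for v k
  proof (cases "{u \<in> neighborhood G v. (f \<circ> c) u = k} = {}")
    case True
    show ?thesis unfolding True by simp
  next
    case False
    then obtain w where w: "w \<in> neighborhood G v" "f (c w) = k" by auto
    then have "{u \<in> neighborhood G v. (f \<circ> c) u = k} = {u \<in> neighborhood G v. c u = c w}"
      using inj_on_eq_iff[OF f] by (auto simp: neighborhood_def)
    then show ?thesis
      using c v by (simp add: frugal_coloring_def)
  qed
  ultimately have "frugal_coloring t G (f \<circ> c)"
    by (simp add: frugal_coloring_def)
  then have "frugal_chromatic_number t G \<le> card ((f \<circ> c) ` pverts G)"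
    unfolding frugal_chromatic_number_def by (intro Least_le) blast
  also have "\<dots> = card (c ` pverts G)"
    using card_image[OF f] by (simp add: image_comp)
  finally show ?thesis .
qed

lemma card_le_mult_card_image:
  assumes "finite A" and "\<And>k. card {x \<in> A. f x = k} \<le> t"
  shows "card A \<le> t * card (f ` A)"
proof -
  have "card A = card (\<Union>k\<in>f ` A. {x \<in> A. f x = k})"
    by (rule arg_cong[where f = card]) auto
  also have "\<dots> \<le> (\<Sum>k\<in>f ` A. card {x \<in> A. f x = k})"
    using assms(1) by (intro card_UN_le) simp
  also have "\<dots> \<le> t * card (f ` A)"
    using sum_bounded_above[of "f ` A" "\<lambda>k. card {x \<in> A. f x = k}" t] assms(2)
    by (simp add: mult.commute)
  finally show ?thesis .
qed

section \<open>The lexicographic product\<close>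

lemma neighborhood_lex_product:
  assumes "simple_graph G" "simple_graph H" "g \<in> pverts G" "h \<in> pverts H"
  shows "neighborhood (lex_product G H) (g, h) =
    neighborhood G g \<times> pverts H \<union> {g} \<times> neighborhood H h"
  using assms by (auto simp: neighborhood_def lex_product_def)

lemma frugal_coloring_fibre:
  assumes G: "simple_graph G" and H: "simple_graph H" and g: "g \<in> pverts G"
    and c: "frugal_coloring t (lex_product G H) c"
  shows "frugal_coloring t H (\<lambda>h. c (g, h))"
  unfolding frugal_coloring_def
proof (intro conjI ballI allI)
  show "proper_coloring H (\<lambda>h. c (g, h))"
    unfolding proper_coloring_def
  proof clarify
    fix u v assume uv: "(u, v) \<in> parcs H" and "c (g, u) = c (g, v)"
    moreover have "((g, u), (g, v)) \<in> parcs (lex_product G H)"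
      using uv g simple_graph_arc_verts[OF H uv] by (simp add: lex_product_def)
    ultimately show False
      using c by (auto simp: frugal_coloring_def proper_coloring_def)
  qed
next
  fix h k assume h: "h \<in> pverts H"
  let ?N = "neighborhood (lex_product G H) (g, h)"
  have "finite ?N"
    using simple_graph_lex_product[OF G H]
    by (simp add: neighborhood_def simple_graph_finite_verts)
  moreover have "Pair g ` {u \<in> neighborhood H h. c (g, u) = k} \<subseteq> {u \<in> ?N. c u = k}"
    using neighborhood_lex_product[OF G H g h] by auto
  ultimately have "card (Pair g ` {u \<in> neighborhood H h. c (g, u) = k}) \<le> card {u \<in> ?N. c u = k}"
    by (intro card_mono) auto
  also have "\<dots> \<le> t"
    using c g h by (simp add: frugal_coloring_def lex_product_def)
  finally show "card {u \<in> neighborhood H h. c (g, u) = k} \<le> t"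
    by (simp add: card_image inj_on_def)
qed

text \<open>
  The colors on the fibre over a vertex \<open>g\<close> of maximum degree and the colors over the neighbours
  of \<open>g\<close> are disjoint sets.  The first has at least \<open>\<chi>(H)\<close> elements, and the second is the image of
  \<open>\<Delta>(G) |V(H)|\<close> vertices with at most \<open>t\<close> vertices to each color.  The inequality is multiplied by
  \<open>t\<close> to keep it within the natural numbers.
\<close>

lemma frugal_chromatic_number_lex_product_lower:
  assumes G: "simple_graph G" and H: "simple_graph H" and t: "t \<ge> 1"
  shows "t * frugal_chromatic_number t H + max_degree G * card (pverts H)
    \<le> t * frugal_chromatic_number t (lex_product G H)"
proof -
  let ?P = "lex_product G H"
  have P: "simple_graph ?P" using G H by (rule simple_graph_lex_product)
  obtain c :: "_ \<Rightarrow> nat" where c: "frugal_coloring t ?P c"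
    and card_c: "card (c ` pverts ?P) = frugal_chromatic_number t ?P"
    using frugal_chromatic_number_attained[OF P t] by blast
  obtain g where g: "g \<in> pverts G" and deg: "card (neighborhood G g) = max_degree G"
    using max_degree_attained[OF G] .
  obtain h where h: "h \<in> pverts H" using H by (auto simp: simple_graph_def)
  define F where "F = {g} \<times> pverts H"
  define N where "N = neighborhood G g \<times> pverts H"
  have FN: "F \<union> N \<subseteq> pverts ?P"
    using g by (auto simp: F_def N_def lex_product_def neighborhood_def)
  have fin: "finite F" "finite N"
    using finite_subset[OF FN simple_graph_finite_verts[OF P]] by auto

  have "frugal_chromatic_number t H \<le> card ((\<lambda>h. c (g, h)) ` pverts H)"
    using frugal_chromatic_number_le[OF H frugal_coloring_fibre[OF G H g c]] .
  also have "(\<lambda>h. c (g, h)) ` pverts H = c ` F"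
    by (auto simp: F_def)
  finally have fibre: "frugal_chromatic_number t H \<le> card (c ` F)" .

  have "card {u \<in> N. c u = k} \<le> t" for k
  proof -
    let ?M = "{u \<in> neighborhood ?P (g, h). c u = k}"
    have "finite ?M"
      using simple_graph_finite_verts[OF P] by (simp add: neighborhood_def)
    moreover have "{u \<in> N. c u = k} \<subseteq> ?M"
      using neighborhood_lex_product[OF G H g h] by (auto simp: N_def)
    ultimately have "card {u \<in> N. c u = k} \<le> card ?M"
      by (rule card_mono)
    also have "\<dots> \<le> t"
      using c g h by (simp add: frugal_coloring_def lex_product_def)
    finally show ?thesis .
  qed
  then have "card N \<le> t * card (c ` N)"
    using fin by (intro card_le_mult_card_image)
  then have nbrs: "max_degree G * card (pverts H) \<le> t * card (c ` N)"
    using deg by (simp add: N_def card_cartesian_product)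

  have "(x, y) \<in> parcs ?P" if "x \<in> F" "y \<in> N" for x y
    using that g by (auto simp: F_def N_def neighborhood_def lex_product_def)
  then have "c ` F \<inter> c ` N = {}"
    using c unfolding frugal_coloring_def proper_coloring_def by blast
  then have "card (c ` F) + card (c ` N) = card (c ` (F \<union> N))"
    using fin by (simp add: image_Un card_Un_disjoint)
  also have "\<dots> \<le> card (c ` pverts ?P)"
    using FN simple_graph_finite_verts[OF P] by (intro card_mono) auto
  finally have "t * (card (c ` F) + card (c ` N)) \<le> t * frugal_chromatic_number t ?P"
    by (simp add: card_c)
  moreover have "t * frugal_chromatic_number t H \<le> t * card (c ` F)"
    using fibre by (rule mult_le_mono2)
  ultimately show ?thesis
    using nbrs unfolding distrib_left by linarith
qed

text \<open>
  Consider the neighbours of \<open>(g, h)\<close> of color \<open>(k, i)\<close>: all have second coordinate \<open>i\<close>.  If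
  \<open>k = c g\<close>, properness of \<open>c\<close> leaves only \<open>(g, i)\<close>, and one vertex is within the bound because
  \<open>t \<ge> 1\<close>.  Otherwise their first coordinates are neighbours of \<open>g\<close> of color \<open>k\<close>.
\<close>

lemma frugal_coloring_lex_product:
  assumes G: "simple_graph G" and H: "simple_graph H" and t: "t \<ge> 1"
    and c: "frugal_coloring t G c"
  shows "frugal_coloring t (lex_product G H) (\<lambda>(g, h). (c g, h))"
  unfolding frugal_coloring_def
proof (intro conjI ballI allI)
  have proper: "c u \<noteq> c v" if "(u, v) \<in> parcs G" for u v
    using c that by (auto simp: frugal_coloring_def proper_coloring_def)
  moreover have "(h, h) \<notin> parcs H" for h
    using simple_graph_arc_verts(3)[OF H] by blast
  ultimately show "proper_coloring (lex_product G H) (\<lambda>(g, h). (c g, h))"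
    by (auto simp: proper_coloring_def lex_product_def)
  fix v and q :: "'c \<times> 'b"
  assume v: "v \<in> pverts (lex_product G H)"
  obtain g h where gh: "v = (g, h)" "g \<in> pverts G" "h \<in> pverts H"
    using v by (auto simp: lex_product_def)
  obtain k i where q: "q = (k, i)" by (rule prod.exhaust)
  let ?S = "{u \<in> neighborhood (lex_product G H) v. (\<lambda>(g, h). (c g, h)) u = q}"
  let ?C = "{u \<in> neighborhood G g. c u = k}"
  note nb = neighborhood_lex_product[OF G H gh(2,3)]
  show "card ?S \<le> t"
  proof (cases "k = c g")
    case True
    then have "?S \<subseteq> {(g, i)}"
      unfolding gh(1) q nb by (auto simp: neighborhood_def dest: proper)
    then have "card ?S \<le> 1"
      using card_mono[of "{(g, i)}" ?S] by simp
    then show ?thesis using t by linarith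
  next
    case False
    then have "?S \<subseteq> (\<lambda>u. (u, i)) ` ?C"
      unfolding gh(1) q nb by auto
    moreover have "finite ?C"
      using simple_graph_finite_verts[OF G] by (simp add: neighborhood_def)
    ultimately have "card ?S \<le> card ?C"
      by (rule surj_card_le[rotated])
    also have "\<dots> \<le> t"
      using c gh(2) by (simp add: frugal_coloring_def)
    finally show ?thesis .
  qed
qed

lemma frugal_chromatic_number_lex_product_upper:
  assumes G: "simple_graph G" and H: "simple_graph H" and t: "t \<ge> 1"
  shows "frugal_chromatic_number t (lex_product G H)
    \<le> frugal_chromatic_number t G * card (pverts H)"
proof -
  obtain c :: "'a \<Rightarrow> nat" where c: "frugal_coloring t G c"
    and card_c: "card (c ` pverts G) = frugal_chromatic_number t G"
    using frugal_chromatic_number_attained[OF G t] by blast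
  have "frugal_chromatic_number t (lex_product G H)
      \<le> card ((\<lambda>(g, h). (c g, h)) ` pverts (lex_product G H))"
    using simple_graph_lex_product[OF G H] frugal_coloring_lex_product[OF G H t c]
    by (rule frugal_chromatic_number_le)
  also have "(\<lambda>(g, h). (c g, h)) ` pverts (lex_product G H) = (c ` pverts G) \<times> pverts H"
    by (force simp: lex_product_def)
  finally show ?thesis
    by (simp add: card_cartesian_product card_c)
qed

lemma frugal_chromatic_number_lex_product_bounds:
  assumes "simple_graph G" "simple_graph H"
  shows "int (frugal_chromatic_number 2 H) + \<lceil>real (max_degree G * card (pverts H)) / 2\<rceil>
      \<le> int (frugal_chromatic_number 2 (lex_product G H))"
    and "frugal_chromatic_number 2 (lex_product G H)
      \<le> frugal_chromatic_number 2 G * card (pverts H)"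
proof -
  have "2 * frugal_chromatic_number 2 H + max_degree G * card (pverts H)
      \<le> 2 * frugal_chromatic_number 2 (lex_product G H)"
    using frugal_chromatic_number_lex_product_lower[OF assms, of 2] by simp
  then have "real (max_degree G * card (pverts H)) / 2
      \<le> of_int (int (frugal_chromatic_number 2 (lex_product G H)) - int (frugal_chromatic_number 2 H))"
    unfolding of_int_diff of_int_of_nat_eq by linarith
  then have "\<lceil>real (max_degree G * card (pverts H)) / 2\<rceil>
      \<le> int (frugal_chromatic_number 2 (lex_product G H)) - int (frugal_chromatic_number 2 H)"
    by (rule ceiling_le)
  then show "int (frugal_chromatic_number 2 H) + \<lceil>real (max_degree G * card (pverts H)) / 2\<rceil>
      \<le> int (frugal_chromatic_number 2 (lex_product G H))"
    by (simp only: le_diff_eq add.commute)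
  show "frugal_chromatic_number 2 (lex_product G H)
      \<le> frugal_chromatic_number 2 G * card (pverts H)"
    using assms by (rule frugal_chromatic_number_lex_product_upper) simp
qed

section \<open>Sharpness\<close>

definition complete_graph :: "nat \<Rightarrow> nat pair_pre_digraph" where
  "complete_graph n = \<lparr> pverts = {..<n}, parcs = {(u, v). u < n \<and> v < n \<and> u \<noteq> v} \<rparr>"

lemma simple_graph_complete_graph:
  assumes "n \<ge> 1"
  shows "simple_graph (complete_graph n)"
proof -
  have "parcs (complete_graph n) \<subseteq> {..<n} \<times> {..<n}"
    by (auto simp: complete_graph_def)
  then have "finite (parcs (complete_graph n))"
    by (rule finite_subset) simp
  moreover have "symmetric (complete_graph n)"
    by (auto simp: complete_graph_def symmetric_def sym_def)
  ultimately have "pair_graph (complete_graph n)"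
    by unfold_locales (auto simp: complete_graph_def)
  moreover have "0 \<in> pverts (complete_graph n)"
    using assms by (simp add: complete_graph_def)
  ultimately show ?thesis
    by (auto simp: simple_graph_def)
qed

lemma max_degree_complete_graph:
  assumes "n \<ge> 1"
  shows "max_degree (complete_graph n) = n - 1"
proof -
  obtain v where v: "v \<in> pverts (complete_graph n)"
    and "card (neighborhood (complete_graph n) v) = max_degree (complete_graph n)"
    using max_degree_attained[OF simple_graph_complete_graph[OF assms]] .
  moreover have "neighborhood (complete_graph n) v = {..<n} - {v}"
    using v by (auto simp: neighborhood_def complete_graph_def)
  ultimately show ?thesis
    by (simp add: complete_graph_def)
qed

lemma frugal_chromatic_number_le_card_verts:
  assumes "simple_graph G" "t \<ge> 1"
  shows "frugal_chromatic_number t G \<le> card (pverts G)"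
  using frugal_chromatic_number_attained[OF assms] simple_graph_finite_verts[OF assms(1)]
  by (metis card_image_le)

lemma frugal_chromatic_number_pos:
  assumes "simple_graph G" "t \<ge> 1"
  shows "frugal_chromatic_number t G \<ge> 1"
proof -
  obtain c :: "'a \<Rightarrow> nat" where "card (c ` pverts G) = frugal_chromatic_number t G"
    using frugal_chromatic_number_attained[OF assms] by blast
  moreover have "card (c ` pverts G) > 0"
    using assms simple_graph_finite_verts[OF assms(1)]
    by (simp add: card_gt_0_iff simple_graph_def)
  ultimately show ?thesis by linarith
qed

text \<open>
  For \<open>K\<^sub>2\<close> and \<open>K\<^sub>1\<close> the lower bound is at least \<open>1 + \<lceil>1 / 2\<rceil> = 2\<close>, and the upper bound is at most
  \<open>2 \<cdot> 1 = 2\<close> because \<open>K\<^sub>2\<close> has only two vertices; so all three quantities agree.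
\<close>

lemma frugal_bounds_sharp_complete_graph:
  defines "G \<equiv> complete_graph 2" and "H \<equiv> complete_graph 1"
  shows "int (frugal_chromatic_number 2 H) + \<lceil>real (max_degree G * card (pverts H)) / 2\<rceil>
      = int (frugal_chromatic_number 2 (lex_product G H))"
    and "frugal_chromatic_number 2 (lex_product G H) = frugal_chromatic_number 2 G * card (pverts H)"
proof -
  have G: "simple_graph G" and H: "simple_graph H"
    by (simp_all add: G_def H_def simple_graph_complete_graph)
  have cards: "card (pverts G) = 2" "card (pverts H) = 1"
    by (simp_all add: G_def H_def complete_graph_def)
  have deg: "max_degree G = 1"
    by (simp add: G_def max_degree_complete_graph)
  have lower: "frugal_chromatic_number 2 H \<ge> 1"
    using frugal_chromatic_number_pos[OF H] by simp
  have upper: "frugal_chromatic_number 2 G \<le> 2"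
    using frugal_chromatic_number_le_card_verts[OF G, of 2] cards by simp
  have half: "\<lceil>real (max_degree G * card (pverts H)) / 2\<rceil> = 1"
    by (simp add: deg cards ceiling_eq_iff)
  have "int (frugal_chromatic_number 2 H) + 1 \<le> int (frugal_chromatic_number 2 (lex_product G H))"
    using frugal_chromatic_number_lex_product_bounds(1)[OF G H] unfolding half .
  moreover have "frugal_chromatic_number 2 (lex_product G H) \<le> frugal_chromatic_number 2 G"
    using frugal_chromatic_number_lex_product_bounds(2)[OF G H] unfolding cards mult_1_right .
  ultimately have vals: "frugal_chromatic_number 2 H = 1" "frugal_chromatic_number 2 G = 2"
      "frugal_chromatic_number 2 (lex_product G H) = 2"
    using lower upper by linarith+
  show "int (frugal_chromatic_number 2 H) + \<lceil>real (max_degree G * card (pverts H)) / 2\<rceil>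
      = int (frugal_chromatic_number 2 (lex_product G H))"
    unfolding half vals by simp
  show "frugal_chromatic_number 2 (lex_product G H) = frugal_chromatic_number 2 G * card (pverts H)"
    unfolding cards vals by simp
qed

section \<open>The bounds and their sharpness\<close>

theorem theorem6p6:
  shows "(\<forall>(G :: 'a pair_pre_digraph) (H :: 'b pair_pre_digraph).
      simple_graph G \<and> simple_graph H \<longrightarrow>
        int (frugal_chromatic_number 2 H) + \<lceil>real (max_degree G * card (pverts H)) / 2\<rceil>
          \<le> int (frugal_chromatic_number 2 (lex_product G H)) \<and>
        frugal_chromatic_number 2 (lex_product G H)
          \<le> frugal_chromatic_number 2 G * card (pverts H))
    \<and> (\<exists>(G :: nat pair_pre_digraph) (H :: nat pair_pre_digraph).
      simple_graph G \<and> simple_graph H \<and>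
        int (frugal_chromatic_number 2 H) + \<lceil>real (max_degree G * card (pverts H)) / 2\<rceil>
          = int (frugal_chromatic_number 2 (lex_product G H)))
    \<and> (\<exists>(G :: nat pair_pre_digraph) (H :: nat pair_pre_digraph).
      simple_graph G \<and> simple_graph H \<and>
        frugal_chromatic_number 2 (lex_product G H)
          = frugal_chromatic_number 2 G * card (pverts H))"
proof (intro conjI allI impI)
  fix G :: "'a pair_pre_digraph" and H :: "'b pair_pre_digraph"
  assume GH: "simple_graph G \<and> simple_graph H"
  show "int (frugal_chromatic_number 2 H) + \<lceil>real (max_degree G * card (pverts H)) / 2\<rceil>
      \<le> int (frugal_chromatic_number 2 (lex_product G H))"
    using frugal_chromatic_number_lex_product_bounds(1) GH by blast
  show "frugal_chromatic_number 2 (lex_product G H)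
      \<le> frugal_chromatic_number 2 G * card (pverts H)"
    using frugal_chromatic_number_lex_product_bounds(2) GH by blast
next
  have K: "simple_graph (complete_graph 2)" "simple_graph (complete_graph 1)"
    by (simp_all add: simple_graph_complete_graph)
  show "\<exists>(G :: nat pair_pre_digraph) (H :: nat pair_pre_digraph).
      simple_graph G \<and> simple_graph H \<and>
        int (frugal_chromatic_number 2 H) + \<lceil>real (max_degree G * card (pverts H)) / 2\<rceil>
          = int (frugal_chromatic_number 2 (lex_product G H))"
    using K frugal_bounds_sharp_complete_graph(1)
    by (intro exI[of _ "complete_graph 2"] exI[of _ "complete_graph 1"] conjI)
  show "\<exists>(G :: nat pair_pre_digraph) (H :: nat pair_pre_digraph).
      simple_graph G \<and> simple_graph H \<and>
        frugal_chromatic_number 2 (lex_product G H)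
          = frugal_chromatic_number 2 G * card (pverts H)"
    using K frugal_bounds_sharp_complete_graph(2)
    by (intro exI[of _ "complete_graph 2"] exI[of _ "complete_graph 1"] conjI)
qed

end
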